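(* Fix constants $c,c_1,c_2,C,\kappa>0$, a sequence of positive integers $(D_n)_{n\in\mathbb N}$ with $D_n=\omega(1)$, and a sequence of positive numbers $(B_n)_{n\in\mathbb N}$ with $B_n=\omega(\max\{n^{-C},e^{-CD_n}\})$. For each $n$ let $P_0=P_0^{(n)}$ be a prior on $\mathbb R^n$, let $X,X'$ be i.i.d. from $P_0$, and assume that the overlap $\langle X,X'\rangle$ has a differentiable density, denoted $t\mapsto\mathbb P(\langle X,X'\rangle=t)$. Assume: (1) for all $D>0$, $c_1B_nD^\kappa\le q(D)\le c_2B_nD^\kappa$; (2) $\displaystyle\frac{d}{dt}\log\mathbb P(\langle X,X'\rangle=t)\Big|_{t=q(D_n)}\le-\frac{c}{q(D_n)}$. Then there exists a constant $C'>0$ such that for any $u>0$ satisfying $u+\frac{d}{dq}\mathcal F_{\mathrm{ann},u}(q)\big|_{q=q(D_n)}>0$ we have $$\big(\mathrm{Corr}^{\le D_n}_{P_0}\big)^2\!\left(u+\frac{d}{dq}\mathcal F_{\mathrm{ann},u}(q)\Big|_{q=q(D_n)}\right)\ge\frac{C'}{D_n^{2\kappa}}\,q(D_n).$$ In particular, for any SNR $\lambda>0$, $\big(\mathrm{Corr}^{\le D_n}_{P_0}\big)^2(\lambda)\le\frac{C'}{D_n^{2\kappa}}q(D_n)$ implies $\frac{d}{dq}\mathcal F_{\mathrm{ann},\lambda}(q)\big|_{q=q(D_n)}\ge0$.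
   Context: Gaussian additive model (GAM) with prior $P_0$ on $\mathbb R^n$ and signal-to-noise ratio (SNR) $\lambda>0$: one observes $Y=\sqrt\lambda X+Z$ with $X\sim P_0$ and independent $Z\sim N(0,I_n)$. Low-degree correlation: $\mathbb R[Y]_{\le D}$ is the space of polynomials in $Y$ of total degree at most $D$, and $$\mathrm{Corr}^{\le D}_{P_0}(\lambda):=\sqrt{\sum_{i=1}^n\ \sup_{g_i\in\mathbb R[Y]_{\le D},\ \mathbb E[g_i(Y)^2]=1}\mathbb E[g_i(Y)X_i]^2}.$$ $(\mathrm{Corr}^{\le D}_{P_0})^2(\lambda)$ denotes its square. Overlap quantile: for i.i.d. $X,X'\sim P_0$ and $D>0$, $q(D):=\inf\{y\in\mathbb R:\ \mathbb P(|\langle X,X'\rangle|\le y)\ge 1-e^{-D}\}$. Annealed Franz–Parisi potential: $\mathcal F_{\mathrm{ann},\lambda}(q):=-\log\mathbb E_{X,X'}\big[1_{\langle X,X'\rangle=q}\,e^{\lambda\langle X,X'\rangle}\big]$, which for an overlap with density means $\mathcal F_{\mathrm{ann},\lambda}(q)=-\lambda q-\log\mathbb P(\langle X,X'\rangle=q)$, where $\mathbb P(\langle X,X'\rangle=q)$ denotes the density of $\langle X,X'\rangle$ at $q$. *)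

theory Defs
  imports "HOL-Probability.Probability" "HOL-Library.Landau_Symbols"
begin

text \<open>The dimension n varies inside the statements, so vectors in n-dimensional space are
  the elements of the product space \<open>\<Pi>\<^sub>M i\<in>{..<n}. borel\<close>, with coordinates 0, ..., n-1.\<close>

definition is_prior :: "nat \<Rightarrow> (nat \<Rightarrow> real) measure \<Rightarrow> bool" where
  "is_prior n P \<longleftrightarrow> prob_space P \<and> sets P = sets (\<Pi>\<^sub>M i\<in>{..<n}. (borel :: real measure))"

definition gam :: "nat \<Rightarrow> (nat \<Rightarrow> real) measure \<Rightarrow> ((nat \<Rightarrow> real) \<times> (nat \<Rightarrow> real)) measure" where
  "gam n P = P \<Otimes>\<^sub>M (\<Pi>\<^sub>M i\<in>{..<n}. std_normal_distribution)"

definition gam_obs :: "nat \<Rightarrow> real \<Rightarrow> (nat \<Rightarrow> real) \<times> (nat \<Rightarrow> real) \<Rightarrow> (nat \<Rightarrow> real)" where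
  "gam_obs n lam = (\<lambda>(x, z). \<lambda>i\<in>{..<n}. sqrt lam * x i + z i)"

definition multi_indices :: "nat \<Rightarrow> nat \<Rightarrow> (nat \<Rightarrow> nat) set" where
  "multi_indices n D = {\<alpha> \<in> {..<n} \<rightarrow>\<^sub>E UNIV. (\<Sum>i<n. \<alpha> i) \<le> D}"

text \<open>Polynomials in n real variables of total degree at most D, as polynomial functions.\<close>

definition polys_le :: "nat \<Rightarrow> nat \<Rightarrow> ((nat \<Rightarrow> real) \<Rightarrow> real) set" where
  "polys_le n D =
     {g. \<exists>a :: (nat \<Rightarrow> nat) \<Rightarrow> real.
           g = (\<lambda>y. \<Sum>\<alpha>\<in>multi_indices n D. a \<alpha> * (\<Prod>i<n. y i ^ \<alpha> i))}"

text \<open>The supremum is taken in the reals. If the coordinates of X have finite second moments, it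
  ranges over a nonempty set (it contains the value at \<open>g = 1\<close>) that is bounded above, by
  Cauchy-Schwarz. The constraint that the (Bochner) integral of \<open>g(Y)\<^sup>2\<close> is 1 includes its
  integrability.\<close>

definition Corr :: "nat \<Rightarrow> nat \<Rightarrow> (nat \<Rightarrow> real) measure \<Rightarrow> real \<Rightarrow> real" where
  "Corr n D P lam =
     sqrt (\<Sum>i<n. SUP g \<in> {g \<in> polys_le n D. (\<integral>w. (g (gam_obs n lam w))\<^sup>2 \<partial>gam n P) = 1}.
                    (\<integral>w. g (gam_obs n lam w) * fst w i \<partial>gam n P)\<^sup>2)"

definition overlap :: "nat \<Rightarrow> (nat \<Rightarrow> real) \<times> (nat \<Rightarrow> real) \<Rightarrow> real" where
  "overlap n = (\<lambda>(x, x'). \<Sum>i<n. x i * x' i)"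

definition overlap_quantile :: "nat \<Rightarrow> (nat \<Rightarrow> real) measure \<Rightarrow> real \<Rightarrow> real" where
  "overlap_quantile n P d =
     Inf {y. measure (P \<Otimes>\<^sub>M P) {w \<in> space (P \<Otimes>\<^sub>M P). \<bar>overlap n w\<bar> \<le> y} \<ge> 1 - exp (- d)}"

text \<open>A differentiable density of the overlap is continuous, hence uniquely determined.\<close>

definition differentiable_overlap_density ::
    "nat \<Rightarrow> (nat \<Rightarrow> real) measure \<Rightarrow> (real \<Rightarrow> real) \<Rightarrow> bool" where
  "differentiable_overlap_density n P p \<longleftrightarrow>
     (\<forall>t. 0 \<le> p t) \<and> (\<forall>t. p differentiable (at t)) \<and>
     distributed (P \<Otimes>\<^sub>M P) lborel (overlap n) (\<lambda>t. ennreal (p t))"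

text \<open>Annealed Franz-Parisi potential for an overlap with density p. The expectation of
  \<open>exp (lam * overlap)\<close> restricted to the event that the overlap equals q is read as a density
  in q, that is, as \<open>exp (lam * q) * p q\<close>.\<close>

definition FP_ann :: "(real \<Rightarrow> real) \<Rightarrow> real \<Rightarrow> real \<Rightarrow> real" where
  "FP_ann p lam q = - lam * q - ln (p q)"

end

theory Submission
  imports Defs "HOL-Real_Asymp.Real_Asymp"
begin

text \<open>Test functions of degree 1 already suffice. Let \<open>M\<close> be the matrix of second moments of the
  prior and \<open>F\<^sup>2\<close> its squared Frobenius norm, which is also the second moment of the overlap. The
  linear test functions \<open>(M Y)\<^sub>i\<close> show that the squared correlation at SNR \<open>lam\<close> is at least
  \<open>lam * F\<^sup>2 / (lam * F + 1)\<close>, which increases both in \<open>lam\<close> and in \<open>F\<close>. The SNR in the theorem is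
  minus the logarithmic derivative of the density, hence at least \<open>c / q\<close>. The lower quantile
  bound at level 1 and Markov's inequality give \<open>F \<ge> a * c2 * B n\<close> with a constant \<open>a\<close>, and
  \<open>q \<le> c2 * B n * D n powr \<kappa>\<close>. The upper quantile bounds at all levels give stretched exponential
  tails, so that \<open>F\<close> is finite; finiteness of the second moments of the prior follows, and this
  makes the suprema in the correlation genuine.\<close>

section \<open>Square-integrable functions, polynomials and Gaussian noise\<close>

text \<open>Fubini for independent factors. \<open>has_bochner_integral\<close> carries
  integrability along with the value, so later expansions into sums need no separate integrability
  proofs.\<close>

lemma (in sigma_finite_measure) has_bochner_integral_pair_times:
  fixes f :: "'b \<Rightarrow> real" and g :: "'a \<Rightarrow> real"
  assumes "sigma_finite_measure N" "has_bochner_integral N f a" "has_bochner_integral M g b"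
  shows "has_bochner_integral (N \<Otimes>\<^sub>M M) (\<lambda>w. f (fst w) * g (snd w)) (a * b)"
proof -
  interpret N: sigma_finite_measure N by fact
  interpret pair_sigma_finite N M ..
  have f: "integrable N f" "integral\<^sup>L N f = a" and g: "integrable M g" "integral\<^sup>L M g = b"
    using assms by (auto simp: has_bochner_integral_iff)
  have [measurable]: "f \<in> borel_measurable N" "g \<in> borel_measurable M"
    using f g by auto
  have int: "integrable (N \<Otimes>\<^sub>M M) (\<lambda>w. f (fst w) * g (snd w))"
    by (rule Fubini_integrable) (auto simp: abs_mult f g)
  have "(\<integral>w. f (fst w) * g (snd w) \<partial>(N \<Otimes>\<^sub>M M)) = (\<integral>x. \<integral>y. f x * g y \<partial>M \<partial>N)"
    using integral_fst'[OF int] by simp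
  then show ?thesis
    using int by (simp add: has_bochner_integral_iff f g)
qed

lemma abs_mult_le_sum_squares: "\<bar>a * b :: real\<bar> \<le> a\<^sup>2 + b\<^sup>2"
proof -
  have "0 \<le> (\<bar>a\<bar> - \<bar>b\<bar>)\<^sup>2" by simp
  then have "2 * (\<bar>a\<bar> * \<bar>b\<bar>) \<le> a\<^sup>2 + b\<^sup>2"
    by (simp add: power2_diff)
  moreover have "0 \<le> \<bar>a\<bar> * \<bar>b\<bar>" by simp
  ultimately show ?thesis
    unfolding abs_mult by linarith
qed

lemma integrable_times_square_integrable:
  fixes f g :: "'a \<Rightarrow> real"
  assumes [measurable]: "f \<in> borel_measurable M" "g \<in> borel_measurable M"
    and "integrable M (\<lambda>x. (f x)\<^sup>2)" "integrable M (\<lambda>x. (g x)\<^sup>2)"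
  shows "integrable M (\<lambda>x. f x * g x)"
proof (rule Bochner_Integration.integrable_bound)
  show "integrable M (\<lambda>x. (f x)\<^sup>2 + (g x)\<^sup>2)"
    using assms by simp
  show "AE x in M. norm (f x * g x) \<le> norm ((f x)\<^sup>2 + (g x)\<^sup>2)"
    using abs_mult_le_sum_squares by simp
qed simp

text \<open>If \<open>g * f\<close> is not integrable, its integral is the junk value 0.\<close>

lemma integral_times_normalized_le:
  fixes f g :: "'a \<Rightarrow> real"
  assumes f: "integrable M (\<lambda>x. (f x)\<^sup>2)" and g: "(\<integral>x. (g x)\<^sup>2 \<partial>M) = 1"
  shows "(\<integral>x. g x * f x \<partial>M)\<^sup>2 \<le> (\<integral>x. (f x)\<^sup>2 \<partial>M)"
proof (cases "integrable M (\<lambda>x. g x * f x)")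
  case True
  define t where "t = (\<integral>x. g x * f x \<partial>M)"
  have int_g: "integrable M (\<lambda>x. (g x)\<^sup>2)"
    using g not_integrable_integral_eq by fastforce
  have "0 \<le> (\<integral>x. (f x - t * g x)\<^sup>2 \<partial>M)"
    by simp
  also have "\<dots> = (\<integral>x. ((f x)\<^sup>2 - 2 * t * (g x * f x)) + t\<^sup>2 * (g x)\<^sup>2 \<partial>M)"
    by (intro Bochner_Integration.integral_cong refl) (simp add: power2_eq_square algebra_simps)
  also have "\<dots> = (\<integral>x. (f x)\<^sup>2 \<partial>M) - t\<^sup>2"
    using f True int_g by (simp add: g t_def[symmetric]) (simp add: power2_eq_square)
  finally show ?thesis
    by (simp add: t_def)
next
  case False
  then show ?thesis
    by (simp add: not_integrable_integral_eq)
qed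

section \<open>Polynomials of bounded total degree\<close>

lemma finite_multi_indices: "finite (multi_indices n D)"
proof (rule finite_subset)
  show "multi_indices n D \<subseteq> {..<n} \<rightarrow>\<^sub>E {..D}"
  proof
    fix \<alpha> assume \<alpha>: "\<alpha> \<in> multi_indices n D"
    have "\<alpha> i \<le> D" if "i < n" for i
    proof -
      have "\<alpha> i \<le> (\<Sum>i<n. \<alpha> i)"
        using that by (intro member_le_sum) auto
      with \<alpha> show ?thesis by (simp add: multi_indices_def)
    qed
    with \<alpha> show "\<alpha> \<in> {..<n} \<rightarrow>\<^sub>E {..D}"
      by (auto simp: multi_indices_def PiE_iff)
  qed
qed (simp add: finite_PiE)

lemma monomial_in_polys_le:
  assumes "\<alpha> \<in> multi_indices n D"
  shows "(\<lambda>y. \<Prod>i<n. y i ^ \<alpha> i) \<in> polys_le n D"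
  unfolding polys_le_def
  using assms finite_multi_indices[of n D]
  by (auto intro!: exI[of _ "\<lambda>\<beta>. if \<beta> = \<alpha> then 1 else 0"] simp: if_distrib if_distribR cong: if_cong)

lemma polys_le_cmult: "g \<in> polys_le n D \<Longrightarrow> (\<lambda>y. c * g y) \<in> polys_le n D"
proof -
  assume "g \<in> polys_le n D"
  then obtain a where "g = (\<lambda>y. \<Sum>\<alpha>\<in>multi_indices n D. a \<alpha> * (\<Prod>i<n. y i ^ \<alpha> i))"
    by (auto simp: polys_le_def)
  then show ?thesis
    by (auto simp: polys_le_def sum_distrib_left mult.assoc intro!: exI[of _ "\<lambda>\<alpha>. c * a \<alpha>"])
qed

lemma polys_le_add:
  "g \<in> polys_le n D \<Longrightarrow> h \<in> polys_le n D \<Longrightarrow> (\<lambda>y. g y + h y) \<in> polys_le n D"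
proof -
  assume "g \<in> polys_le n D" "h \<in> polys_le n D"
  then obtain a b where "g = (\<lambda>y. \<Sum>\<alpha>\<in>multi_indices n D. a \<alpha> * (\<Prod>i<n. y i ^ \<alpha> i))"
    "h = (\<lambda>y. \<Sum>\<alpha>\<in>multi_indices n D. b \<alpha> * (\<Prod>i<n. y i ^ \<alpha> i))"
    by (auto simp: polys_le_def)
  then show ?thesis
    by (auto simp: polys_le_def distrib_right sum.distrib intro!: exI[of _ "\<lambda>\<alpha>. a \<alpha> + b \<alpha>"])
qed

lemma polys_le_one: "(\<lambda>y. 1) \<in> polys_le n D"
  using monomial_in_polys_le[of "\<lambda>i\<in>{..<n}. 0" n D] by (simp add: multi_indices_def)

lemma prod_power_if_eq: "j < n \<Longrightarrow> (\<Prod>i<n. z i ^ (if i = j then m else 0)) = (z j ^ m :: real)" for n :: nat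
  by (simp add: if_distrib[of "\<lambda>e. _ ^ e"] cong: if_cong)

lemma polys_le_coordinate:
  assumes "j < n" "D > 0"
  shows "(\<lambda>y. y j) \<in> polys_le n D"
proof -
  have "(\<lambda>i\<in>{..<n}. if i = j then 1 else 0) \<in> multi_indices n D"
    using assms by (simp add: multi_indices_def)
  from monomial_in_polys_le[OF this] show ?thesis
    using assms prod_power_if_eq[of j n _ 1] by simp
qed

lemma polys_le_linear:
  assumes "D > 0"
  shows "(\<lambda>y. \<Sum>j<n. a j * y j) \<in> polys_le n D"
proof -
  have "(\<lambda>y. \<Sum>j<m. a j * y j) \<in> polys_le n D" if "m \<le> n" for m
    using that
  proof (induction m)
    case 0
    show ?case
      using polys_le_cmult[OF polys_le_one, of 0] by simp
  next
    case (Suc m)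
    then show ?case
      using polys_le_add[OF _ polys_le_cmult[OF polys_le_coordinate]] assms by simp
  qed
  then show ?thesis by simp
qed

section \<open>First and second moments of the noise\<close>

lemma has_bochner_integral_std_normal_monomial:
  assumes "k \<le> 2"
  shows "has_bochner_integral std_normal_distribution (\<lambda>x. x ^ k) (if k = 1 then 0 else 1)"
proof -
  have "integral\<^sup>L std_normal_distribution (\<lambda>x. x ^ k) = (if k = 1 then 0 else 1)"
  proof -
    consider "k = 0" | "k = 1" | "k = 2" using assms by linarith
    then show ?thesis
      using std_normal_distribution_even_moments(1)[of 0] std_normal_distribution_even_moments(1)[of 1]
        integral_std_normal_distribution_moment_odd[of 1]
      by cases simp_all
  qed
  then show ?thesis
    using integrable_std_normal_distribution_moment has_bochner_integral_iff by blast
qed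

lemma has_bochner_integral_noise:
  fixes j k n :: nat
  assumes "j < n" "k < n"
  shows "has_bochner_integral (\<Pi>\<^sub>M i\<in>{..<n}. std_normal_distribution) (\<lambda>z. z j) 0"
    and "has_bochner_integral (\<Pi>\<^sub>M i\<in>{..<n}. std_normal_distribution) (\<lambda>z. z j * z k)
           (if j = k then 1 else 0)"
proof -
  interpret prob_space "std_normal_distribution :: real measure"
    by (rule prob_space_normal_density) simp
  interpret product_sigma_finite "\<lambda>_. std_normal_distribution" ..
  \<comment> \<open>The coordinates of the noise are independent, so the mean of a monomial is a
    product of one-dimensional moments; exponents 0, 1, 2 give the moments 1, 0, 1.\<close>
  have monomial: "has_bochner_integral (\<Pi>\<^sub>M i\<in>{..<n}. std_normal_distribution)
      (\<lambda>z. \<Prod>i<n. z i ^ e i) v"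
    if "\<And>i. e i \<le> 2" "(\<Prod>i<n. if e i = 1 then 0 else 1) = v" for e :: "nat \<Rightarrow> nat" and v
    using product_integrable_prod[of "{..<n}" "\<lambda>i x. x ^ e i"]
      product_integral_prod[of "{..<n}" "\<lambda>i x. x ^ e i"]
      has_bochner_integral_std_normal_monomial[OF that(1)] that(2)
    by (simp add: has_bochner_integral_iff)
  have "(\<Prod>i<n. if (if i = j then 1 else 0) = (1::nat) then 0 else 1) = (0::real)"
    using assms by (auto simp: prod_zero_iff)
  from monomial[OF _ this]
  show "has_bochner_integral (\<Pi>\<^sub>M i\<in>{..<n}. std_normal_distribution) (\<lambda>z. z j) 0"
    using assms prod_power_if_eq[of j n _ 1] by simp
  show "has_bochner_integral (\<Pi>\<^sub>M i\<in>{..<n}. std_normal_distribution) (\<lambda>z. z j * z k)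
           (if j = k then 1 else 0)"
  proof (cases "j = k")
    case True
    have "(\<Prod>i<n. if (if i = j then 2 else 0) = (1::nat) then 0 else 1) = (1::real)"
      by (intro prod.neutral) auto
    from monomial[OF _ this] show ?thesis
      using True assms prod_power_if_eq[of j n _ 2] by (simp add: power2_eq_square)
  next
    case False
    \<comment> \<open>For distinct \<open>j\<close> and \<open>k\<close>, adding the exponents
      displays \<open>z j * z k\<close> as one monomial; its factor at \<open>j\<close> has exponent
      1 and hence mean 0.\<close>
    have "z i ^ ((if i = j then 1 else 0) + (if i = k then 1 else 0)) =
        z i ^ (if i = j then 1 else 0) * z i ^ (if i = k then 1 else 0)" for z :: "nat \<Rightarrow> real" and i
      by (simp add: power_add)
    then have "(\<Prod>i<n. z i ^ ((if i = j then 1 else 0) + (if i = k then 1 else 0))) = z j * z k"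
      for z :: "nat \<Rightarrow> real"
      using prod_power_if_eq[of j n z 1] prod_power_if_eq[of k n z 1] assms
      by (simp add: prod.distrib)
    moreover have "(\<Prod>i<n. if (if i = j then 1 else 0) + (if i = k then 1 else 0) = (1::nat) then 0 else 1)
        = (0::real)"
      using assms False by (auto simp: prod_zero_iff intro!: bexI[of _ j])
    from monomial[OF _ this] have "has_bochner_integral (\<Pi>\<^sub>M i\<in>{..<n}. std_normal_distribution)
        (\<lambda>z. \<Prod>i<n. z i ^ ((if i = j then 1 else 0) + (if i = k then 1 else 0))) (0::real)"
      by simp
    ultimately show ?thesis
      using False by simp
  qed
qed

section \<open>The correlation achieved by linear polynomials\<close>

lemma measurable_prior_coordinate:
  "is_prior n P \<Longrightarrow> i < n \<Longrightarrow> (\<lambda>x. x i) \<in> borel_measurable P"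
  using measurable_component_singleton[of i "{..<n}" "\<lambda>_. borel"]
  by (simp add: is_prior_def cong: measurable_cong_sets)

text \<open>For the priors of the theorem, square integrability is derived from the quantile bounds
  by way of \<open>square_integrable_of_overlap\<close>.\<close>

locale square_integrable_prior =
  fixes n :: nat and P :: "(nat \<Rightarrow> real) measure"
  assumes prior: "is_prior n P"
    and square_integrable: "i < n \<Longrightarrow> integrable P (\<lambda>x. (x i)\<^sup>2)"
begin

sublocale prob_space P
  using prior by (simp add: is_prior_def)

lemmas measurable_coordinate [measurable] = measurable_prior_coordinate[OF prior]

definition moment :: "nat \<Rightarrow> nat \<Rightarrow> real" where
  "moment i j = (\<integral>x. x i * x j \<partial>P)"

definition row_norm2 :: "nat \<Rightarrow> real" where
  "row_norm2 i = (\<Sum>j<n. (moment i j)\<^sup>2)"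

lemma moment_commute: "moment i j = moment j i"
  by (simp add: moment_def mult.commute)

lemma has_bochner_integral_moment:
  "i < n \<Longrightarrow> j < n \<Longrightarrow> has_bochner_integral P (\<lambda>x. x i * x j) (moment i j)"
  by (simp add: has_bochner_integral_iff moment_def integrable_times_square_integrable square_integrable)

lemma integrable_coordinate: "i < n \<Longrightarrow> integrable P (\<lambda>x. x i)"
  using integrable_times_square_integrable[of "\<lambda>_. 1" P "\<lambda>x. x i"] square_integrable by simp

section \<open>Integration over the joint law of signal and noise\<close>

lemma prob_space_noise: "prob_space (\<Pi>\<^sub>M i\<in>{..<n}. std_normal_distribution :: real measure)"
  by (intro prob_space_PiM prob_space_normal_density) simp

lemma has_bochner_integral_gam:
  fixes f g :: "(nat \<Rightarrow> real) \<Rightarrow> real"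
  assumes "has_bochner_integral P f a"
    and "has_bochner_integral (\<Pi>\<^sub>M i\<in>{..<n}. std_normal_distribution) g b"
  shows "has_bochner_integral (gam n P) (\<lambda>w. f (fst w) * g (snd w)) (a * b)"
proof -
  interpret N: prob_space "\<Pi>\<^sub>M i\<in>{..<n}. std_normal_distribution :: real measure"
    by (rule prob_space_noise)
  show ?thesis
    unfolding gam_def
    by (intro N.has_bochner_integral_pair_times assms sigma_finite_measure_axioms)
qed

lemma has_bochner_integral_gam_fst:
  fixes f :: "(nat \<Rightarrow> real) \<Rightarrow> real"
  assumes "has_bochner_integral P f a"
  shows "has_bochner_integral (gam n P) (\<lambda>w. f (fst w)) a"
proof -
  interpret N: prob_space "\<Pi>\<^sub>M i\<in>{..<n}. std_normal_distribution :: real measure"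
    by (rule prob_space_noise)
  show ?thesis
    using has_bochner_integral_gam[OF assms, of "\<lambda>_. 1" 1]
    by (simp add: has_bochner_integral_iff N.prob_space)
qed

lemma has_bochner_integral_gam_snd:
  fixes g :: "(nat \<Rightarrow> real) \<Rightarrow> real"
  assumes "has_bochner_integral (\<Pi>\<^sub>M i\<in>{..<n}. std_normal_distribution) g b"
  shows "has_bochner_integral (gam n P) (\<lambda>w. g (snd w)) b"
  using has_bochner_integral_gam[OF _ assms, of "\<lambda>_. 1" 1]
  by (simp add: has_bochner_integral_iff prob_space)

lemma has_bochner_integral_obs_signal:
  assumes "j < n" "i < n"
  shows "has_bochner_integral (gam n P) (\<lambda>w. gam_obs n lam w j * fst w i) (sqrt lam * moment j i)"
proof -
  have "has_bochner_integral (gam n P) (\<lambda>w. sqrt lam * (fst w j * fst w i) + fst w i * snd w j)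
      (sqrt lam * moment j i + (\<integral>x. x i \<partial>P) * 0)"
    using assms integrable_coordinate
    by (intro has_bochner_integral_add has_bochner_integral_mult_right has_bochner_integral_gam
        has_bochner_integral_gam_fst[where f = "\<lambda>x. x j * x i"] has_bochner_integral_moment
        has_bochner_integral_noise(1)[of j n j] has_bochner_integral_integrable) auto
  also have "(\<lambda>w. sqrt lam * (fst w j * fst w i) + fst w i * snd w j) =
      (\<lambda>w. gam_obs n lam w j * fst w i)"
    using assms by (auto simp: gam_obs_def algebra_simps)
  finally show ?thesis by simp
qed

text \<open>The mixed terms vanish because the noise is centred and independent of the signal; what
  remains is the matrix lam * M + I.\<close>

lemma has_bochner_integral_obs_obs:
  assumes "j < n" "k < n" "lam \<ge> 0"
  shows "has_bochner_integral (gam n P) (\<lambda>w. gam_obs n lam w j * gam_obs n lam w k)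
    (lam * moment j k + (if j = k then 1 else 0))"
proof -
  have "has_bochner_integral (gam n P) (\<lambda>w. lam * (fst w j * fst w k) + sqrt lam * (fst w j * snd w k)
        + sqrt lam * (fst w k * snd w j) + snd w j * snd w k)
      (lam * moment j k + sqrt lam * ((\<integral>x. x j \<partial>P) * 0) + sqrt lam * ((\<integral>x. x k \<partial>P) * 0)
        + (if j = k then 1 else 0))"
    using assms integrable_coordinate
    by (intro has_bochner_integral_add has_bochner_integral_mult_right has_bochner_integral_gam
        has_bochner_integral_gam_fst[where f = "\<lambda>x. x j * x k"]
        has_bochner_integral_gam_snd[where g = "\<lambda>x. x j * x k"] has_bochner_integral_moment
        has_bochner_integral_noise has_bochner_integral_integrable) auto
  also have "(\<lambda>w. lam * (fst w j * fst w k) + sqrt lam * (fst w j * snd w k)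
        + sqrt lam * (fst w k * snd w j) + snd w j * snd w k) =
      (\<lambda>w. gam_obs n lam w j * gam_obs n lam w k)"
  proof
    fix w :: "(nat \<Rightarrow> real) \<times> (nat \<Rightarrow> real)"
    \<comment> \<open>The simplifier would contract the product of the two roots again, so this
      expansion is applied separately and \<open>real_sqrt_mult_self\<close> is deleted
      afterwards.\<close>
    have "lam * (fst w j * fst w k) = (sqrt lam * sqrt lam) * (fst w j * fst w k)"
      using assms by simp
    then show "lam * (fst w j * fst w k) + sqrt lam * (fst w j * snd w k)
        + sqrt lam * (fst w k * snd w j) + snd w j * snd w k = gam_obs n lam w j * gam_obs n lam w k"
      using assms by (simp only:) (simp add: gam_obs_def split_beta algebra_simps del: real_sqrt_mult_self)
  qed
  finally show ?thesis by simp
qed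

lemma integral_linear_obs_signal:
  assumes "i < n"
  shows "(\<integral>w. (\<Sum>j<n. a j * gam_obs n lam w j) * fst w i \<partial>gam n P) =
    sqrt lam * (\<Sum>j<n. a j * moment j i)"
proof -
  have "has_bochner_integral (gam n P) (\<lambda>w. \<Sum>j<n. a j * (gam_obs n lam w j * fst w i))
      (\<Sum>j<n. a j * (sqrt lam * moment j i))"
    using assms by (intro has_bochner_integral_sum has_bochner_integral_mult_right
        has_bochner_integral_obs_signal) auto
  then show ?thesis
    by (simp add: has_bochner_integral_iff sum_distrib_left sum_distrib_right algebra_simps)
qed

lemma integral_linear_obs_square:
  assumes "lam \<ge> 0"
  shows "(\<integral>w. (\<Sum>j<n. a j * gam_obs n lam w j)\<^sup>2 \<partial>gam n P) =
    lam * (\<Sum>j<n. \<Sum>k<n. a j * a k * moment j k) + (\<Sum>j<n. (a j)\<^sup>2)"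
proof -
  have "has_bochner_integral (gam n P)
      (\<lambda>w. \<Sum>j<n. \<Sum>k<n. a j * a k * (gam_obs n lam w j * gam_obs n lam w k))
      (\<Sum>j<n. \<Sum>k<n. a j * a k * (lam * moment j k + (if j = k then 1 else 0)))"
    using assms by (intro has_bochner_integral_sum has_bochner_integral_mult_right
        has_bochner_integral_obs_obs) auto
  moreover have "(\<Sum>j<n. \<Sum>k<n. a j * a k * (gam_obs n lam w j * gam_obs n lam w k)) =
      (\<Sum>j<n. a j * gam_obs n lam w j)\<^sup>2" for w
    by (simp add: power2_eq_square sum_product algebra_simps)
  moreover have "a j * a k * (lam * moment j k + (if j = k then 1 else 0)) =
      lam * (a j * a k * moment j k) + (if j = k then a j * a k else 0)" for j k
    by (simp add: algebra_simps)
  then have "(\<Sum>j<n. \<Sum>k<n. a j * a k * (lam * moment j k + (if j = k then 1 else 0))) =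
      lam * (\<Sum>j<n. \<Sum>k<n. a j * a k * moment j k) + (\<Sum>j<n. (a j)\<^sup>2)"
    by (simp add: sum.distrib sum_distrib_left[symmetric] power2_eq_square)
  ultimately show ?thesis
    by (simp add: has_bochner_integral_iff)
qed

section \<open>The suprema in the correlation\<close>

text \<open>Cauchy-Schwarz bounds each value by E[X_i^2]. Without a bound, \<open>SUP\<close> over
  the reals is unspecified and test functions would say nothing about it.\<close>

lemma bdd_above_correlations:
  assumes "i < n"
  shows "bdd_above ((\<lambda>g. (\<integral>w. g (gam_obs n lam w) * fst w i \<partial>gam n P)\<^sup>2) `
    {g \<in> polys_le n D. (\<integral>w. (g (gam_obs n lam w))\<^sup>2 \<partial>gam n P) = 1})"
proof -
  have "integrable (gam n P) (\<lambda>w. (fst w i)\<^sup>2)"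
    using has_bochner_integral_gam_fst[OF has_bochner_integral_moment[OF assms assms]]
    by (simp add: has_bochner_integral_iff power2_eq_square)
  from integral_times_normalized_le[OF this] show ?thesis
    by (intro bdd_aboveI[of _ "\<integral>w. (fst w i)\<^sup>2 \<partial>gam n P"]) auto
qed

definition max_correlation2 :: "nat \<Rightarrow> real \<Rightarrow> nat \<Rightarrow> real" where
  "max_correlation2 D lam i =
    (SUP g \<in> {g \<in> polys_le n D. (\<integral>w. (g (gam_obs n lam w))\<^sup>2 \<partial>gam n P) = 1}.
       (\<integral>w. g (gam_obs n lam w) * fst w i \<partial>gam n P)\<^sup>2)"

lemma max_correlation2_upper:
  assumes "i < n" "g \<in> polys_le n D" "(\<integral>w. (g (gam_obs n lam w))\<^sup>2 \<partial>gam n P) = 1"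
  shows "(\<integral>w. g (gam_obs n lam w) * fst w i \<partial>gam n P)\<^sup>2 \<le> max_correlation2 D lam i"
  unfolding max_correlation2_def
  using assms by (intro cSUP_upper bdd_above_correlations) auto

text \<open>The constant 1 is an admissible test function, so the supremum is at least a
  square.\<close>

lemma max_correlation2_nonneg:
  assumes "i < n"
  shows "0 \<le> max_correlation2 D lam i"
proof -
  have "has_bochner_integral P (\<lambda>_. 1::real) 1"
    by (simp add: has_bochner_integral_iff prob_space)
  from has_bochner_integral_gam_fst[OF this] have "(\<integral>w. 1\<^sup>2 \<partial>gam n P) = (1::real)"
    by (simp add: has_bochner_integral_iff)
  from max_correlation2_upper[OF assms polys_le_one this] show ?thesis
    by (rule order_trans[OF zero_le_power2])
qed

text \<open>Rescaling by \<open>1 / sqrt N\<close> makes \<open>g\<close> admissible.\<close>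

lemma max_correlation2_ge:
  assumes "i < n" "g \<in> polys_le n D" and pos: "(\<integral>w. (g (gam_obs n lam w))\<^sup>2 \<partial>gam n P) = N" "N > 0"
  shows "(\<integral>w. g (gam_obs n lam w) * fst w i \<partial>gam n P)\<^sup>2 / N \<le> max_correlation2 D lam i"
proof -
  have "(\<integral>w. (1 / sqrt N * g (gam_obs n lam w))\<^sup>2 \<partial>gam n P) = 1"
    using pos by (simp add: power_divide)
  from max_correlation2_upper[OF assms(1) polys_le_cmult[OF assms(2)] this] show ?thesis
    using pos by (simp add: power_divide)
qed

lemma Corr_square: "(Corr n D P lam)\<^sup>2 = (\<Sum>i<n. max_correlation2 D lam i)"
  unfolding Corr_def max_correlation2_def[symmetric]
  by (subst real_sqrt_pow2) (auto intro: sum_nonneg max_correlation2_nonneg)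

section \<open>The bound achieved by the rows of the moment matrix\<close>

text \<open>The left-hand side is the Frobenius inner product of M with m m^T, where m is row
  \<open>i\<close> of M. Cauchy-Schwarz over index pairs applies, and m m^T has Frobenius norm
  \<open>row_norm2 i\<close>.\<close>

lemma moment_quadratic_form_le:
  "(\<Sum>j<n. \<Sum>k<n. moment i j * moment i k * moment j k) \<le> row_norm2 i * sqrt (\<Sum>j<n. row_norm2 j)"
proof (rule power2_le_imp_le)
  have "(\<Sum>j<n. \<Sum>k<n. moment i j * moment i k * moment j k)\<^sup>2 =
      (\<Sum>x\<in>{..<n}\<times>{..<n}. (moment i (fst x) * moment i (snd x)) * moment (fst x) (snd x))\<^sup>2"
    by (simp add: sum.cartesian_product split_beta)
  also have "\<dots> \<le> (\<Sum>x\<in>{..<n}\<times>{..<n}. (moment i (fst x) * moment i (snd x))\<^sup>2) *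
      (\<Sum>x\<in>{..<n}\<times>{..<n}. (moment (fst x) (snd x))\<^sup>2)"
    by (rule Cauchy_Schwarz_ineq_sum)
  also have "(\<Sum>x\<in>{..<n}\<times>{..<n}. (moment i (fst x) * moment i (snd x))\<^sup>2) = (row_norm2 i)\<^sup>2"
    by (simp add: row_norm2_def power2_eq_square[of "sum _ _"] sum_product sum.cartesian_product
        split_beta power_mult_distrib)
  also have "(\<Sum>x\<in>{..<n}\<times>{..<n}. (moment (fst x) (snd x))\<^sup>2) = (sqrt (\<Sum>j<n. row_norm2 j))\<^sup>2"
    by (simp add: row_norm2_def sum.cartesian_product split_beta sum_nonneg)
  finally show "(\<Sum>j<n. \<Sum>k<n. moment i j * moment i k * moment j k)\<^sup>2 \<le>
      (row_norm2 i * sqrt (\<Sum>j<n. row_norm2 j))\<^sup>2"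
    by (simp only: power_mult_distrib)
qed (simp add: row_norm2_def sum_nonneg)

text \<open>The test function for coordinate \<open>i\<close> is \<open>(M Y)\<^sub>i\<close>, where \<open>M\<close> is the matrix of second
  moments. The optimal linear test function involves \<open>(lam * M + I)\<^sup>-\<^sup>1 M\<close> instead; this one
  keeps everything polynomial in the entries of \<open>M\<close>.\<close>

lemma max_correlation2_ge_row:
  assumes "i < n" "D > 0" "lam > 0"
  shows "lam * row_norm2 i / (lam * sqrt (\<Sum>j<n. row_norm2 j) + 1) \<le> max_correlation2 D lam i"
\<comment> \<open>For a zero row the test function vanishes identically and cannot be normalised,
  but the bound is then 0.\<close>
proof (cases "row_norm2 i = 0")
  case True
  then show ?thesis
    using assms max_correlation2_nonneg by simp
next
  case False
  define F where "F = sqrt (\<Sum>j<n. row_norm2 j)"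
  define s where "s = row_norm2 i"
  define N where "N = lam * (\<Sum>j<n. \<Sum>k<n. moment i j * moment i k * moment j k) + s"
  have "s \<ge> 0"
    by (simp add: s_def row_norm2_def sum_nonneg)
  with False have "s > 0" by (simp add: s_def)
  have "F \<ge> 0"
    by (simp add: F_def row_norm2_def sum_nonneg)
  have N: "(\<integral>w. (\<Sum>j<n. moment i j * gam_obs n lam w j)\<^sup>2 \<partial>gam n P) = N"
    using assms by (simp add: integral_linear_obs_square N_def s_def row_norm2_def)
  have E: "(\<integral>w. (\<Sum>j<n. moment i j * gam_obs n lam w j) * fst w i \<partial>gam n P) = sqrt lam * s"
    using assms integral_linear_obs_signal[of i "moment i" lam]
    by (simp add: s_def row_norm2_def moment_commute[of _ i] power2_eq_square)
  \<comment> \<open>The quadratic form is the second moment of the linear combination of the X_j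
    with coefficients \<open>moment i j\<close>; hence \<open>N\<close> is at least
    \<open>s\<close>.\<close>
  have "0 \<le> (\<Sum>j<n. \<Sum>k<n. moment i j * moment i k * moment j k)"
  proof -
    have "has_bochner_integral P (\<lambda>x. \<Sum>j<n. \<Sum>k<n. moment i j * moment i k * (x j * x k))
        (\<Sum>j<n. \<Sum>k<n. moment i j * moment i k * moment j k)"
      by (intro has_bochner_integral_sum has_bochner_integral_mult_right has_bochner_integral_moment) auto
    moreover have "(\<Sum>j<n. \<Sum>k<n. moment i j * moment i k * (x j * x k)) = (\<Sum>j<n. moment i j * x j)\<^sup>2" for x
      by (simp add: power2_eq_square sum_product algebra_simps)
    ultimately have "has_bochner_integral P (\<lambda>x. (\<Sum>j<n. moment i j * x j)\<^sup>2)
        (\<Sum>j<n. \<Sum>k<n. moment i j * moment i k * moment j k)"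
      by simp
    then show ?thesis
      by (subst has_bochner_integral_integral_eq[symmetric])
        (assumption, intro Bochner_Integration.integral_nonneg zero_le_power2)
  qed
  with \<open>s > 0\<close> assms have "N > 0"
    by (simp add: N_def add_nonneg_pos)
  have "N \<le> lam * (s * F) + s"
    unfolding N_def using moment_quadratic_form_le[of i] assms
    by (simp add: F_def s_def)
  then have N_le: "N \<le> s * (lam * F + 1)"
    by (simp add: algebra_simps)
  have "lam * s / (lam * F + 1) = lam * s\<^sup>2 / (s * (lam * F + 1))"
    using \<open>s > 0\<close> by (simp add: power2_eq_square)
  also have "\<dots> \<le> lam * s\<^sup>2 / N"
    using \<open>N > 0\<close> N_le \<open>s > 0\<close> \<open>F \<ge> 0\<close> assms
    by (intro divide_left_mono mult_pos_pos add_nonneg_pos) auto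
  also have "\<dots> = (sqrt lam * s)\<^sup>2 / N"
    using assms by (simp add: power_mult_distrib)
  also have "\<dots> \<le> max_correlation2 D lam i"
    using max_correlation2_ge[OF assms(1) polys_le_linear[OF assms(2)] N \<open>N > 0\<close>] by (simp add: E)
  finally show ?thesis
    by (simp add: s_def F_def)
qed

text \<open>The row bounds share one denominator, so their numerators simply add up.\<close>

lemma Corr_square_ge:
  assumes "D > 0" "lam > 0"
  defines "S \<equiv> \<Sum>i<n. row_norm2 i"
  shows "lam * S / (lam * sqrt S + 1) \<le> (Corr n D P lam)\<^sup>2"
proof -
  have "lam * S / (lam * sqrt S + 1) = (\<Sum>i<n. lam * row_norm2 i / (lam * sqrt S + 1))"
    by (simp add: S_def sum_distrib_left sum_divide_distrib)
  also have "\<dots> \<le> (\<Sum>i<n. max_correlation2 D lam i)"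
    unfolding S_def using assms by (intro sum_mono max_correlation2_ge_row) auto
  finally show ?thesis
    by (simp add: Corr_square)
qed

text \<open>The squared overlap is the double sum of X_i X_j X'_i X'_j, and independence of the two
  copies turns each mean into the square of an entry of M.\<close>

lemma has_bochner_integral_overlap_square:
  "has_bochner_integral (P \<Otimes>\<^sub>M P) (\<lambda>w. (overlap n w)\<^sup>2) (\<Sum>i<n. row_norm2 i)"
proof -
  have "has_bochner_integral (P \<Otimes>\<^sub>M P)
      (\<lambda>w. \<Sum>i<n. \<Sum>j<n. (fst w i * fst w j) * (snd w i * snd w j))
      (\<Sum>i<n. \<Sum>j<n. moment i j * moment i j)"
    by (intro has_bochner_integral_sum has_bochner_integral_moment sigma_finite_measure_axioms
        has_bochner_integral_pair_times[where f = "\<lambda>x. x _ * x _" and g = "\<lambda>x. x _ * x _"]) auto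
  moreover have "(\<Sum>i<n. \<Sum>j<n. (fst w i * fst w j) * (snd w i * snd w j)) = (overlap n w)\<^sup>2"
    for w :: "(nat \<Rightarrow> real) \<times> (nat \<Rightarrow> real)"
    by (simp add: overlap_def split_beta power2_eq_square sum_product algebra_simps)
  ultimately show ?thesis
    by (simp add: row_norm2_def power2_eq_square)
qed

end

section \<open>Quantiles and second moments\<close>

context prob_space
begin

section \<open>Tail bounds from quantiles\<close>

lemma prob_abs_greater:
  assumes [measurable]: "X \<in> borel_measurable M"
  shows "prob {w \<in> space M. \<bar>X w\<bar> > y} = 1 - prob {w \<in> space M. \<bar>X w :: real\<bar> \<le> y}"
proof -
  have "{w \<in> space M. \<bar>X w\<bar> > y} = space M - {w \<in> space M. \<bar>X w\<bar> \<le> y}"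
    by auto
  then show ?thesis
    by (simp add: prob_compl)
qed

text \<open>As \<open>y\<close> is strictly above the infimum, some member of the set lies below
  \<open>y\<close>, and monotonicity carries its bound over to \<open>y\<close>.\<close>

lemma quantile_tail_le:
  fixes X :: "'a \<Rightarrow> real"
  assumes [measurable]: "X \<in> borel_measurable M" and "d > 0"
    and y: "Inf {y. prob {w \<in> space M. \<bar>X w\<bar> \<le> y} \<ge> 1 - exp (- d)} < y"
  shows "prob {w \<in> space M. \<bar>X w\<bar> > y} \<le> exp (- d)"
proof -
  \<comment> \<open>The events exhaust the space, so the set of levels is nonempty; the infimum of
    an empty set of reals would be unspecified.\<close>
  have "(\<Union>k. {w \<in> space M. \<bar>X w\<bar> \<le> real k}) = space M"
    using real_arch_simple by auto
  moreover have "(\<lambda>k. prob {w \<in> space M. \<bar>X w\<bar> \<le> real k}) \<longlonglongrightarrow>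
      prob (\<Union>k. {w \<in> space M. \<bar>X w\<bar> \<le> real k})"
    by (intro finite_Lim_measure_incseq) (auto simp: incseq_def)
  ultimately have "(\<lambda>k. prob {w \<in> space M. \<bar>X w\<bar> \<le> real k}) \<longlonglongrightarrow> 1"
    by (simp add: prob_space)
  then have "\<forall>\<^sub>F k in sequentially. 1 - exp (- d) < prob {w \<in> space M. \<bar>X w\<bar> \<le> real k}"
    by (rule order_tendstoD) simp
  then obtain k where "1 - exp (- d) < prob {w \<in> space M. \<bar>X w\<bar> \<le> real k}"
    using eventually_happens'[OF sequentially_bot] by blast
  then have "{y. prob {w \<in> space M. \<bar>X w\<bar> \<le> y} \<ge> 1 - exp (- d)} \<noteq> {}"
    by (auto intro!: exI[of _ "real k"])
  from cInf_lessD[OF this y] obtain y' where "y' < y"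
    and "1 - exp (- d) \<le> prob {w \<in> space M. \<bar>X w\<bar> \<le> y'}"
    by auto
  note this(2)
  also have "prob {w \<in> space M. \<bar>X w\<bar> \<le> y'} \<le> prob {w \<in> space M. \<bar>X w\<bar> \<le> y}"
    using \<open>y' < y\<close> by (intro finite_measure_mono) auto
  finally show ?thesis
    by (simp add: prob_abs_greater)
qed

lemma quantile_tail_ge:
  fixes X :: "'a \<Rightarrow> real"
  assumes [measurable]: "X \<in> borel_measurable M" and "d > 0"
    and y: "y < Inf {y. prob {w \<in> space M. \<bar>X w\<bar> \<le> y} \<ge> 1 - exp (- d)}"
  shows "exp (- d) \<le> prob {w \<in> space M. \<bar>X w\<bar> > y}"
proof (rule ccontr)
  assume "\<not> ?thesis"
  then have "y \<in> {y. prob {w \<in> space M. \<bar>X w\<bar> \<le> y} \<ge> 1 - exp (- d)}"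
    by (simp add: prob_abs_greater)
  \<comment> \<open>Negative levels have probability 0, which is less than 1 - exp (- d); this
    bounds the set below and makes its infimum genuine.\<close>
  moreover have "bdd_below {y. prob {w \<in> space M. \<bar>X w\<bar> \<le> y} \<ge> 1 - exp (- d)}"
  proof (rule bdd_belowI)
    fix y assume y: "y \<in> {y. prob {w \<in> space M. \<bar>X w\<bar> \<le> y} \<ge> 1 - exp (- d)}"
    show "0 \<le> y"
    proof (rule ccontr)
      assume "\<not> 0 \<le> y"
      then have "{w \<in> space M. \<bar>X w\<bar> \<le> y} = {}"
        by auto
      then have "prob {w \<in> space M. \<bar>X w\<bar> \<le> y} = 0"
        by (simp only: measure_empty)
      with y \<open>d > 0\<close> show False
        by simp
    qed
  qed
  ultimately have "Inf {y. prob {w \<in> space M. \<bar>X w\<bar> \<le> y} \<ge> 1 - exp (- d)} \<le> y"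
    by (rule cInf_lower)
  with y show False
    by simp
qed

text \<open>Slicing at natural levels: where |X| lies above \<open>K * k powr \<kappa>\<close> and
  up to \<open>K * (k + 1) powr \<kappa>\<close>, its square is at most \<open>b k\<close>, and this
  has probability at most exp (- k). The exponential beats the power.\<close>

lemma integrable_square_of_stretched_exponential_tail:
  fixes X :: "'a \<Rightarrow> real"
  assumes [measurable]: "X \<in> borel_measurable M" and "K > 0" "\<kappa> > 0"
    and tail: "\<And>d. d > 0 \<Longrightarrow> prob {w \<in> space M. \<bar>X w\<bar> > K * d powr \<kappa>} \<le> exp (- d)"
  shows "integrable M (\<lambda>w. (X w)\<^sup>2)"
proof (rule integrableI_bounded)
  define A where "A k = {w \<in> space M. \<bar>X w\<bar> > K * real k powr \<kappa>}" for k
  define b where "b k = (K * (real k + 1) powr \<kappa>)\<^sup>2" for k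
  have [measurable]: "A k \<in> sets M" for k
    unfolding A_def by measurable
  have prob_A: "prob (A k) \<le> exp (- real k)" for k
    using tail[of "real k"] by (cases "k = 0") (auto simp: A_def)
  have "summable (\<lambda>k. b k * exp (- real k))"
  proof (rule summable_comparison_test_bigo)
    show "summable (\<lambda>k. norm (1 / real k ^ 2))"
      using inverse_power_summable[of 2] by (simp add: field_simps)
    show "(\<lambda>k. b k * exp (- real k)) \<in> O(\<lambda>k. 1 / real k ^ 2)"
      unfolding b_def using \<open>\<kappa> > 0\<close> \<open>K > 0\<close> by real_asymp
  qed
  then have sum: "(\<Sum>k. ennreal (b k * exp (- real k))) \<noteq> \<infinity>"
    by (simp add: ennreal_suminf_neq_top b_def)
  have pointwise: "ennreal (norm ((X w)\<^sup>2)) \<le> (\<Sum>k. ennreal (b k) * indicator (A k) w)"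
    if w: "w \<in> space M" for w
  proof (cases "X w = 0")
    case False
    define u where "u = (\<bar>X w\<bar> / K) powr (1 / \<kappa>)"
    have "u > 0"
      using False \<open>K > 0\<close> by (simp add: u_def)
    have X: "\<bar>X w\<bar> = K * u powr \<kappa>"
      using False \<open>K > 0\<close> \<open>\<kappa> > 0\<close> by (simp add: u_def powr_powr)
    \<comment> \<open>\<open>k\<close> satisfies k < u \<le> k + 1 and so is not always the floor of
      \<open>u\<close>: membership in \<open>A k\<close> asks for a strict inequality.\<close>
    define k where "k = nat \<lceil>u\<rceil> - 1"
    have k: "real k < u" "u \<le> real k + 1"
      using \<open>u > 0\<close> unfolding k_def by linarith+
    have "real k powr \<kappa> < u powr \<kappa>"
      using k \<open>\<kappa> > 0\<close> by (intro powr_less_mono2) auto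
    then have "w \<in> A k"
      using w \<open>K > 0\<close> by (simp add: A_def X)
    have "\<bar>X w\<bar> \<le> K * (real k + 1) powr \<kappa>"
      unfolding X using k \<open>\<kappa> > 0\<close> \<open>K > 0\<close> \<open>u > 0\<close> by (intro mult_left_mono powr_mono2) auto
    then have "(X w)\<^sup>2 \<le> b k"
      unfolding b_def by (rule abs_le_square_iff[THEN iffD1, OF order_trans]) simp
    define f where "f k = ennreal (b k) * indicator (A k) w" for k
    have "ennreal (norm ((X w)\<^sup>2)) \<le> f k"
      using \<open>w \<in> A k\<close> \<open>(X w)\<^sup>2 \<le> b k\<close> by (simp add: f_def ennreal_leI)
    also have "\<dots> \<le> (\<Sum>k. f k)"
      using sum_le_suminf[of f "{k}"] by simp
    finally show ?thesis
      by (simp add: f_def)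
  qed simp
  have "(\<integral>\<^sup>+w. ennreal (norm ((X w)\<^sup>2)) \<partial>M) \<le> (\<integral>\<^sup>+w. (\<Sum>k. ennreal (b k) * indicator (A k) w) \<partial>M)"
    by (intro nn_integral_mono pointwise)
  also have "\<dots> = (\<Sum>k. ennreal (b k) * emeasure M (A k))"
    by (subst nn_integral_suminf) (simp_all add: nn_integral_cmult_indicator)
  also have "\<dots> \<le> (\<Sum>k. ennreal (b k * exp (- real k)))"
  proof (intro suminf_le)
    fix k show "ennreal (b k) * emeasure M (A k) \<le> ennreal (b k * exp (- real k))"
      using prob_A[of k]
      by (simp add: emeasure_eq_measure ennreal_mult'[symmetric] b_def ennreal_leI mult_left_mono)
  qed auto
  also have "\<dots> < \<infinity>"
    using sum by (simp add: less_top)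
  finally show "(\<integral>\<^sup>+w. ennreal (norm ((X w)\<^sup>2)) \<partial>M) < \<infinity>" .
qed simp

end

section \<open>Finite second moments of the prior\<close>

lemma measurable_overlap:
  assumes "is_prior n P"
  shows "overlap n \<in> borel_measurable (P \<Otimes>\<^sub>M P)"
proof -
  note [measurable] = measurable_prior_coordinate[OF assms]
  show ?thesis
    unfolding overlap_def split_beta by measurable
qed

text \<open>Truncating \<open>X\<close> to a bounded set, all second moments exist and the squares of the diagonal ones
  are at most the second moment of the overlap, whatever the truncation.\<close>

lemma square_integrable_of_overlap:
  assumes prior: "is_prior n P" and ovl: "integrable (P \<Otimes>\<^sub>M P) (\<lambda>w. (overlap n w)\<^sup>2)"
  shows "square_integrable_prior n P"
proof
  fix l assume l: "l < n"
  interpret prob_space P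
    using prior by (simp add: is_prior_def)
  note [measurable] = measurable_prior_coordinate[OF prior] measurable_overlap[OF prior]
  \<comment> \<open>This cutoff bounds all products of coordinates at once. Each copy has its own
    cutoff, so integrals over the pair still factor.\<close>
  define T where "T k x = (if (\<Sum>j<n. \<bar>x j\<bar>) \<le> real k then 1 else 0 :: real)" for k and x :: "nat \<Rightarrow> real"
  have [measurable]: "T k \<in> borel_measurable P" for k
    unfolding T_def by measurable
  define m where "m k i j = (\<integral>x. x i * x j * T k x \<partial>P)" for k i j
  have int: "integrable P (\<lambda>x. x i * x j * T k x)" if "i < n" "j < n" for i j k
  proof (rule Bochner_Integration.integrable_bound)
    show "integrable P (\<lambda>x. real k * real k)"
      by simp
    have "\<bar>x i * x j * T k x\<bar> \<le> real k * real k" for x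
    proof (cases "(\<Sum>j<n. \<bar>x j\<bar>) \<le> real k")
      case True
      have "\<bar>x i'\<bar> \<le> real k" if "i' < n" for i'
        using member_le_sum[of i' "{..<n}" "\<lambda>j. \<bar>x j\<bar>"] that True by simp
      then show ?thesis
        using that True by (simp add: T_def abs_mult mult_mono)
    qed (simp add: T_def)
    then show "AE x in P. norm (x i * x j * T k x) \<le> norm (real k * real k)"
      by simp
  qed (use that in measurable)
  have "m k l l \<le> sqrt (\<integral>w. (overlap n w)\<^sup>2 \<partial>(P \<Otimes>\<^sub>M P))" for k
  proof (rule real_le_rsqrt)
    have "has_bochner_integral (P \<Otimes>\<^sub>M P)
        (\<lambda>w. \<Sum>i<n. \<Sum>j<n. (fst w i * fst w j * T k (fst w)) * (snd w i * snd w j * T k (snd w)))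
        (\<Sum>i<n. \<Sum>j<n. m k i j * m k i j)"
      using int by (intro has_bochner_integral_sum sigma_finite_measure_axioms
        has_bochner_integral_pair_times[where f = "\<lambda>x. x _ * x _ * T k x" and g = "\<lambda>x. x _ * x _ * T k x"])
        (auto simp: has_bochner_integral_iff m_def)
    moreover have "(\<Sum>i<n. \<Sum>j<n. (fst w i * fst w j * T k (fst w)) * (snd w i * snd w j * T k (snd w))) =
        (overlap n w)\<^sup>2 * (T k (fst w) * T k (snd w))" for w
      by (simp add: overlap_def split_beta power2_eq_square sum_product sum_distrib_left
          sum_distrib_right algebra_simps)
    ultimately have E: "has_bochner_integral (P \<Otimes>\<^sub>M P) (\<lambda>w. (overlap n w)\<^sup>2 * (T k (fst w) * T k (snd w)))
        (\<Sum>i<n. \<Sum>j<n. m k i j * m k i j)"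
      by simp
    \<comment> \<open>One diagonal entry is kept from the squared Frobenius norm of the truncated
      moments.\<close>
    have "(m k l l)\<^sup>2 \<le> (\<Sum>j<n. m k l j * m k l j)"
      using l member_le_sum[of l "{..<n}" "\<lambda>j. m k l j * m k l j"] by (simp add: power2_eq_square)
    also have "\<dots> \<le> (\<Sum>i<n. \<Sum>j<n. m k i j * m k i j)"
      using l member_le_sum[of l "{..<n}" "\<lambda>i. \<Sum>j<n. m k i j * m k i j"] by (simp add: sum_nonneg)
    also have "\<dots> = (\<integral>w. (overlap n w)\<^sup>2 * (T k (fst w) * T k (snd w)) \<partial>(P \<Otimes>\<^sub>M P))"
      using E by (simp add: has_bochner_integral_iff)
    also have "\<dots> \<le> (\<integral>w. (overlap n w)\<^sup>2 \<partial>(P \<Otimes>\<^sub>M P))"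
      using E ovl by (intro integral_mono) (auto simp: has_bochner_integral_iff T_def)
    finally show "(m k l l)\<^sup>2 \<le> (\<integral>w. (overlap n w)\<^sup>2 \<partial>(P \<Otimes>\<^sub>M P))" .
  qed
  \<comment> \<open>The truncated moments increase in \<open>k\<close> and are bounded, hence
    converge; monotone convergence then gives integrability of the limit.\<close>
  moreover have mono: "mono (\<lambda>k. x l * x l * T k x)" for x
    by (intro monoI mult_left_mono) (auto simp: T_def)
  then have "incseq (\<lambda>k. m k l l)"
    unfolding m_def using int[OF l l] by (intro monoI integral_mono) (auto dest: monoD)
  ultimately obtain L where L: "(\<lambda>k. m k l l) \<longlonglongrightarrow> L"
    using incseq_convergent by blast
  have lim: "(\<lambda>k. x l * x l * T k x) \<longlonglongrightarrow> (x l)\<^sup>2" for x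
  proof (rule tendsto_eventually)
    have "\<forall>\<^sub>F k in sequentially. (\<Sum>j<n. \<bar>x j\<bar>) \<le> real k"
      by (rule filterlim_real_sequentially[unfolded filterlim_at_top, THEN spec])
    then show "\<forall>\<^sub>F k in sequentially. x l * x l * T k x = (x l)\<^sup>2"
      by eventually_elim (simp add: T_def power2_eq_square)
  qed
  show "integrable P (\<lambda>x. (x l)\<^sup>2)"
    by (rule integrable_monotone_convergence[where f = "\<lambda>k x. x l * x l * T k x" and x = L])
      (use int[OF l l] mono lim L l in \<open>auto simp: m_def\<close>)
qed (fact prior)

section \<open>The Franz-Parisi criterion\<close>

text \<open>The potential depends on \<open>u\<close> only through a linear term, so adding
  \<open>u\<close> to its derivative gives the same number for all \<open>u\<close>: this is the SNR
  in the theorem.\<close>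

lemma deriv_FP_ann:
  assumes "p differentiable (at q)" "p q > 0"
  shows "deriv (FP_ann p u) q = - u - deriv (\<lambda>t. ln (p t)) q"
proof -
  from assms(1) obtain p' where "(p has_real_derivative p') (at q)"
    by (auto simp: real_differentiable_def)
  then have ln_p: "((\<lambda>t. ln (p t)) has_real_derivative p' / p q) (at q)"
    using assms(2) by (auto intro!: derivative_eq_intros)
  then have "((\<lambda>t. - u * t - ln (p t)) has_real_derivative - u * 1 - p' / p q) (at q)"
    by (intro DERIV_diff DERIV_cmult DERIV_ident)
  then have "deriv (FP_ann p u) q = - u - p' / p q"
    by (intro DERIV_imp_deriv) (simp add: FP_ann_def[abs_def])
  with DERIV_imp_deriv[OF ln_p] show ?thesis
    by simp
qed

text \<open>The right-hand side of the bound from linear test functions increases with the SNR, so only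
  the smallest admissible SNR \<open>c / q\<close> matters.\<close>

lemma linear_correlation_bound_mono:
  fixes F f c q lam :: real
  assumes "0 < f" "f \<le> F" "c > 0" "q > 0" "lam \<ge> c / q"
  shows "c * f\<^sup>2 / (c * f + q) \<le> lam * F\<^sup>2 / (lam * F + 1)"
proof -
  have pos: "F > 0" "lam > 0" "c * f + q > 0" "c * F + q > 0"
    using assms by (auto intro!: add_pos_pos less_le_trans[OF divide_pos_pos assms(5)])
  \<comment> \<open>The middle term is the bound for \<open>F\<close> at SNR \<open>c / q\<close>,
    denominators cleared: first \<open>f\<close> grows to \<open>F\<close>, then the SNR to
    \<open>lam\<close>.\<close>
  have "c * f\<^sup>2 / (c * f + q) \<le> c * F\<^sup>2 / (c * F + q)"
  proof -
    have "(c * f + q) * F\<^sup>2 - (c * F + q) * f\<^sup>2 = (F - f) * (c * f * F + q * (F + f))"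
      by (simp add: algebra_simps power2_eq_square)
    also have "\<dots> \<ge> 0"
      using assms pos by simp
    finally have "c * (f\<^sup>2 * (c * F + q)) \<le> c * (F\<^sup>2 * (c * f + q))"
      using assms by (intro mult_left_mono) (auto simp: algebra_simps)
    then show ?thesis
      using pos by (simp add: frac_le_eq divide_simps mult_ac)
  qed
  also have "\<dots> \<le> lam * F\<^sup>2 / (lam * F + 1)"
  proof -
    have "c \<le> lam * q"
      using assms by (simp add: pos_divide_le_eq)
    then have "c * (lam * F + 1) \<le> lam * (c * F + q)"
      by (simp add: algebra_simps)
    then have "F\<^sup>2 * (c * (lam * F + 1)) \<le> F\<^sup>2 * (lam * (c * F + q))"
      by (intro mult_left_mono) auto
    moreover have "lam * F + 1 > 0"
      using pos by (intro add_pos_pos) auto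
    ultimately show ?thesis
      using pos by (simp add: divide_simps mult_ac)
  qed
  finally show ?thesis .
qed

text \<open>\<open>b\<close> stands for \<open>B n\<close>, and the constants do not depend on
  \<open>n\<close>. \<open>a\<close> is chosen so that \<open>a * c2 * b\<close> equals
  \<open>c1 * b / 2 * exp (- 1 / 2)\<close>, the bound on F from Markov's inequality.\<close>

lemma Corr_square_ge_quantile:
  fixes b c c1 c2 \<kappa> lam :: real
  assumes "c > 0" "c1 > 0" "c2 > 0" "\<kappa> > 0" "b > 0" "D > 0" and prior: "is_prior n P"
    and quantile: "\<And>d. d > 0 \<Longrightarrow> c1 * b * d powr \<kappa> \<le> overlap_quantile n P d \<and>
      overlap_quantile n P d \<le> c2 * b * d powr \<kappa>"
  defines "a \<equiv> c1 * exp (- 1 / 2) / (2 * c2)" and "q \<equiv> overlap_quantile n P (real D)"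
  assumes lam: "lam \<ge> c / q"
  shows "c * a\<^sup>2 / (c * a + 1) / real D powr (2 * \<kappa>) * q \<le> (Corr n D P lam)\<^sup>2"
proof -
  interpret P: prob_space P
    using prior by (simp add: is_prior_def)
  interpret PP: prob_space "P \<Otimes>\<^sub>M P"
    by (intro prob_space_pair P.prob_space_axioms)
  note [measurable] = measurable_overlap[OF prior]
  \<comment> \<open>The factor 2 makes the threshold strictly exceed the quantile, as
    \<open>quantile_tail_le\<close> requires.\<close>
  have "PP.prob {w \<in> space (P \<Otimes>\<^sub>M P). \<bar>overlap n w\<bar> > 2 * c2 * b * d powr \<kappa>} \<le> exp (- d)"
    if "d > 0" for d
  proof (rule PP.quantile_tail_le)
    have "0 < c2 * b * d powr \<kappa>"
      using assms that by simp
    then show "Inf {y. 1 - exp (- d) \<le> PP.prob {w \<in> space (P \<Otimes>\<^sub>M P). \<bar>overlap n w\<bar> \<le> y}}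
        < 2 * c2 * b * d powr \<kappa>"
      using quantile[OF that] unfolding overlap_quantile_def by linarith
  qed (use that in simp_all)
  then have integrable: "integrable (P \<Otimes>\<^sub>M P) (\<lambda>w. (overlap n w)\<^sup>2)"
    using assms by (intro PP.integrable_square_of_stretched_exponential_tail[of _ "2 * c2 * b" \<kappa>]) auto
  interpret square_integrable_prior n P
    by (rule square_integrable_of_overlap[OF prior integrable])
  define S where "S = (\<Sum>i<n. row_norm2 i)"
  define \<delta> where "\<delta> = real D powr \<kappa>"
  have S_nonneg: "S \<ge> 0"
    by (simp add: S_def row_norm2_def sum_nonneg)
  have "\<delta> \<ge> 1"
    using \<open>D > 0\<close> \<open>\<kappa> > 0\<close> by (simp add: \<delta>_def ge_one_powr_ge_zero)
  have a: "a > 0"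
    using assms by (simp add: a_def)
  have q_le: "q \<le> c2 * b * \<delta>" and "c1 * b * \<delta> \<le> q"
    using quantile[of D] \<open>D > 0\<close> by (auto simp: q_def \<delta>_def)
  moreover have "c1 * b * \<delta> > 0"
    using assms \<open>\<delta> \<ge> 1\<close> by simp
  ultimately have "q > 0"
    by simp
  have "a * c2 * b \<le> sqrt S"
  proof (rule real_le_rsqrt)
    \<comment> \<open>Markov's inequality at level 1: halving \<open>c1 * b\<close> gives a
      threshold strictly below the quantile, exceeded with probability at least exp (- 1).\<close>
    have "exp (- 1) \<le> PP.prob {w \<in> space (P \<Otimes>\<^sub>M P). \<bar>overlap n w\<bar> > c1 * b / 2}"
    proof (rule PP.quantile_tail_ge)
      have "0 < c1 * b"
        using assms by simp
      then show "c1 * b / 2 < Inf {y. 1 - exp (- 1) \<le> PP.prob {w \<in> space (P \<Otimes>\<^sub>M P). \<bar>overlap n w\<bar> \<le> y}}"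
        using quantile[of 1] unfolding overlap_quantile_def by simp
    qed simp_all
    then have "(c1 * b / 2)\<^sup>2 * exp (- 1) \<le>
        (c1 * b / 2)\<^sup>2 * PP.prob {w \<in> space (P \<Otimes>\<^sub>M P). \<bar>overlap n w\<bar> > c1 * b / 2}"
      by (intro mult_left_mono) auto
    also have "\<dots> = (\<integral>w. (c1 * b / 2)\<^sup>2 * indicator {w \<in> space (P \<Otimes>\<^sub>M P). \<bar>overlap n w\<bar> > c1 * b / 2} w
        \<partial>(P \<Otimes>\<^sub>M P))"
      by simp
    also have "\<dots> \<le> (\<integral>w. (overlap n w)\<^sup>2 \<partial>(P \<Otimes>\<^sub>M P))"
    proof (rule integral_mono[OF _ integrable])
      fix w assume "w \<in> space (P \<Otimes>\<^sub>M P)"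
      have "(c1 * b / 2)\<^sup>2 \<le> (overlap n w)\<^sup>2" if "\<bar>overlap n w\<bar> > c1 * b / 2"
        using that assms by (intro abs_le_square_iff[THEN iffD1]) simp
      then show "(c1 * b / 2)\<^sup>2 * indicator {w \<in> space (P \<Otimes>\<^sub>M P). \<bar>overlap n w\<bar> > c1 * b / 2} w
          \<le> (overlap n w)\<^sup>2"
        by (simp add: indicator_def)
    qed (intro integrable_mult_right integrable_real_indicator, simp_all add: PP.emeasure_eq_measure)
    also have "\<dots> = S"
      using has_bochner_integral_overlap_square by (simp add: has_bochner_integral_iff S_def)
    finally show "(a * c2 * b)\<^sup>2 \<le> S"
      using \<open>c2 > 0\<close> by (simp add: a_def power_mult_distrib power_divide exp_double[symmetric] mult_ac)
  qed
  moreover have "a * (q / \<delta>) \<le> a * (c2 * b)"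
    using q_le a \<open>\<delta> \<ge> 1\<close> by (intro mult_left_mono) (auto simp: pos_divide_le_eq)
  ultimately have F: "a * (q / \<delta>) \<le> sqrt S"
    by simp
  \<comment> \<open>Two factors \<delta> are lost: one because q / \<delta> replaces c2 * b, one in
    the denominator, where \<delta> \<ge> 1 gives c * a + \<delta> \<le> (c * a + 1) *
    \<delta>.\<close>
  have "c * a\<^sup>2 / (c * a + 1) / real D powr (2 * \<kappa>) * q = c * a\<^sup>2 * (q / \<delta>) / (c * a * \<delta> + \<delta>)"
    using powr_add[of "real D" \<kappa> \<kappa>] by (simp add: \<delta>_def field_simps)
  also have "\<dots> \<le> c * a\<^sup>2 * (q / \<delta>) / (c * a + \<delta>)"
    using \<open>\<delta> \<ge> 1\<close> \<open>q > 0\<close> a \<open>c > 0\<close>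
    by (intro divide_left_mono mult_pos_pos add_pos_pos) auto
  also have "\<dots> = c * (a * (q / \<delta>))\<^sup>2 / (c * (a * (q / \<delta>)) + q)"
  proof -
    define r where "r = q / \<delta>"
    have r: "r > 0" "q = r * \<delta>"
      using \<open>q > 0\<close> \<open>\<delta> \<ge> 1\<close> by (auto simp: r_def)
    have "c * (a * r)\<^sup>2 / (c * (a * r) + q) = (r * (c * a\<^sup>2 * r)) / (r * (c * a + \<delta>))"
      by (simp add: r(2) power2_eq_square algebra_simps)
    also have "\<dots> = c * a\<^sup>2 * r / (c * a + \<delta>)"
      using r by simp
    finally show ?thesis
      by (simp add: r_def)
  qed
  also have "\<dots> \<le> lam * (sqrt S)\<^sup>2 / (lam * sqrt S + 1)"
    using F a \<open>q > 0\<close> \<open>\<delta> \<ge> 1\<close> \<open>c > 0\<close> lam by (intro linear_correlation_bound_mono) auto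
  also have "\<dots> \<le> (Corr n D P lam)\<^sup>2"
    using Corr_square_ge[of D lam] \<open>D > 0\<close> S_nonneg less_le_trans[OF divide_pos_pos lam] \<open>c > 0\<close> \<open>q > 0\<close>
    by (simp add: S_def)
  finally show ?thesis .
qed

theorem theorem2p9:
  fixes c c1 c2 C \<kappa> :: real
    and D :: "nat \<Rightarrow> nat" and B :: "nat \<Rightarrow> real"
    and P :: "nat \<Rightarrow> (nat \<Rightarrow> real) measure"
    and p :: "nat \<Rightarrow> real \<Rightarrow> real"
  assumes "c > 0" "c1 > 0" "c2 > 0" "C > 0" "\<kappa> > 0"
    and "\<And>n. n \<ge> 1 \<Longrightarrow> D n > 0"
    and "(\<lambda>n. real (D n)) \<in> \<omega>(\<lambda>n. 1)"
    and "\<And>n. n \<ge> 1 \<Longrightarrow> B n > 0"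
    and "B \<in> \<omega>(\<lambda>n. max (real n powr (- C)) (exp (- C * real (D n))))"
    and "\<And>n. n \<ge> 1 \<Longrightarrow> is_prior n (P n)"
    and "\<And>n. n \<ge> 1 \<Longrightarrow> differentiable_overlap_density n (P n) (p n)"
    and "\<And>n d. n \<ge> 1 \<Longrightarrow> d > 0 \<Longrightarrow>
           c1 * B n * d powr \<kappa> \<le> overlap_quantile n (P n) d \<and>
           overlap_quantile n (P n) d \<le> c2 * B n * d powr \<kappa>"
    and "\<And>n. n \<ge> 1 \<Longrightarrow>
           p n (overlap_quantile n (P n) (real (D n))) > 0 \<and>
           deriv (\<lambda>t. ln (p n t)) (overlap_quantile n (P n) (real (D n)))
             \<le> - c / overlap_quantile n (P n) (real (D n))"
  shows "\<exists>C'>0. \<forall>n\<ge>1.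
           (let q = overlap_quantile n (P n) (real (D n)) in
             (\<forall>u>0. u + deriv (FP_ann (p n) u) q > 0 \<longrightarrow>
                (Corr n (D n) (P n) (u + deriv (FP_ann (p n) u) q))\<^sup>2
                  \<ge> C' / real (D n) powr (2 * \<kappa>) * q) \<and>
             (\<forall>lam>0. (Corr n (D n) (P n) lam)\<^sup>2 \<le> C' / real (D n) powr (2 * \<kappa>) * q \<longrightarrow>
                deriv (FP_ann (p n) lam) q \<ge> 0))"
proof -
  define a where "a = c1 * exp (- 1 / 2) / (2 * c2)"
  define K where "K = c * a\<^sup>2 / (c * a + 1)"
  have "a > 0"
    using assms by (simp add: a_def)
  then have "K > 0"
    using assms by (simp add: K_def add_pos_pos)
  show ?thesis
  \<comment> \<open>Halving \<open>K\<close> provides the strict inequality \<open>half\<close>,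
    which the second claim uses because its premise allows equality.\<close>
  proof (intro exI[of _ "K / 2"] conjI allI impI)
    show "K / 2 > 0"
      using \<open>K > 0\<close> by simp
    fix n :: nat assume n: "n \<ge> 1"
    define q where "q = overlap_quantile n (P n) (real (D n))"
    have "c1 * B n * real (D n) powr \<kappa> > 0"
      using assms(2) assms(6)[OF n] assms(8)[OF n] by simp
    then have "q > 0"
      using assms(12)[OF n, of "D n"] assms(6)[OF n] by (simp add: q_def)
    have p: "p n differentiable (at q)" "p n q > 0"
      using assms(11)[OF n] assms(13)[OF n] by (auto simp: differentiable_overlap_density_def q_def)
    define L where "L = deriv (\<lambda>t. ln (p n t)) q"
    have L: "c / q \<le> - L"
      using assms(13)[OF n] by (simp add: L_def q_def)
    have bound: "K / real (D n) powr (2 * \<kappa>) * q \<le> (Corr n (D n) (P n) lam)\<^sup>2" if "lam \<ge> c / q" for lam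
      unfolding K_def a_def q_def
      using that assms(1-3,5) assms(6,8,10)[OF n] assms(12)[OF n]
      by (intro Corr_square_ge_quantile[where b = "B n" and ?c1.0 = c1 and ?c2.0 = c2])
        (auto simp: q_def)
    have half: "K / 2 / real (D n) powr (2 * \<kappa>) * q < K / real (D n) powr (2 * \<kappa>) * q"
      using \<open>K > 0\<close> \<open>q > 0\<close> assms(6)[OF n] by (simp add: divide_simps)
    show "let q = overlap_quantile n (P n) (real (D n)) in
             (\<forall>u>0. u + deriv (FP_ann (p n) u) q > 0 \<longrightarrow>
                (Corr n (D n) (P n) (u + deriv (FP_ann (p n) u) q))\<^sup>2
                  \<ge> K / 2 / real (D n) powr (2 * \<kappa>) * q) \<and>
             (\<forall>lam>0. (Corr n (D n) (P n) lam)\<^sup>2 \<le> K / 2 / real (D n) powr (2 * \<kappa>) * q \<longrightarrow>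
                deriv (FP_ann (p n) lam) q \<ge> 0)"
      \<comment> \<open>After this rewriting the SNR of the first claim is \<open>- L\<close>,
        whatever \<open>u\<close> is.\<close>
      unfolding q_def[symmetric] Let_def deriv_FP_ann[OF p] L_def[symmetric]
    proof (intro conjI allI impI)
      fix u :: real
      show "K / 2 / real (D n) powr (2 * \<kappa>) * q \<le> (Corr n (D n) (P n) (u + (- u - L)))\<^sup>2"
        using bound[of "- L"] L half by simp
    next
      fix lam :: real
      assume "(Corr n (D n) (P n) lam)\<^sup>2 \<le> K / 2 / real (D n) powr (2 * \<kappa>) * q"
      \<comment> \<open>\<open>bound\<close> covers every SNR from \<open>c / q\<close> on and is
        applied to \<open>lam\<close> itself: a small correlation forces \<open>lam < c / q\<close>,
        and \<open>c / q\<close> is at most \<open>- L\<close>.\<close>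
      with bound[of lam] half have "\<not> lam \<ge> c / q"
        by linarith
      with L show "0 \<le> - lam - L"
        by linarith
    qed
  qed
qed

end
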